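(* The space $C(\{0,1\}^{\mathbb{N}})$ of real continuous functions on the Cantor space $\{0,1\}^{\mathbb{N}}$, with the supremum norm, is not light.
   Context: A Banach space $X$ is light if its group $\mathrm{Isom}(X)$ of surjective linear isometries is light, i.e. the Weak Operator Topology (generated by the maps $T\mapsto x^*(Tx)$, $x\in X$, $x^*\in X^*$) and the Strong Operator Topology (pointwise norm convergence on $X$) coincide on $\mathrm{Isom}(X)$. *)

theory Defs
  imports "HOL-Analysis.Analysis"
begin

text \<open>The strong operator topology is the library's \<^const>\<open>strong_operator_topology\<close>; the weak one
  has no library counterpart. The dual of \<open>'a\<close> is the type of bounded linear functionals
  \<open>'a \<Rightarrow>\<^sub>L real\<close>.\<close>

definition weak_operator_topology :: "('a::real_normed_vector \<Rightarrow>\<^sub>L 'b::real_normed_vector) topology"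
  where "weak_operator_topology =
    topology_generated_by
      {{T. blinfun_apply \<phi> (blinfun_apply T x) \<in> U} | (\<phi> :: 'b \<Rightarrow>\<^sub>L real) x U. open U}"

definition Isom :: "('a::real_normed_vector \<Rightarrow>\<^sub>L 'a) set"
  where "Isom = {T. (\<forall>x. norm (blinfun_apply T x) = norm x) \<and> surj (blinfun_apply T)}"

definition light_group :: "('a::real_normed_vector \<Rightarrow>\<^sub>L 'a) set \<Rightarrow> bool"
  where "light_group G \<longleftrightarrow>
    subtopology weak_operator_topology G = subtopology strong_operator_topology G"

text \<open>The sort is \<^class>\<open>real_normed_vector\<close> rather than \<^class>\<open>banach\<close> only because the library's
  completeness instance for bounded continuous functions requires the domain to be in class
  \<^class>\<open>metric_space\<close>, to which \<^typ>\<open>bool\<close> (hence the Cantor space below) does not belong.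
  Completeness of the space in question is proved below.\<close>

definition light_space :: "'a::real_normed_vector itself \<Rightarrow> bool"
  where "light_space (_ :: 'a itself) \<longleftrightarrow> light_group (Isom :: ('a \<Rightarrow>\<^sub>L 'a) set)"

text \<open>\<^typ>\<open>bool\<close> is discrete, and functions carry the product topology.\<close>

type_synonym cantor = "nat \<Rightarrow> bool"

text \<open>\<open>cantor \<Rightarrow>\<^sub>C real\<close> is the library type of bounded continuous functions with the supremum norm.
  The following facts say that it is the Banach space of all continuous functions on the (compact)
  Cantor space.\<close>

lemma compact_UNIV_cantor: "compact (UNIV :: cantor set)"
proof -
  have "compact_space (euclidean :: bool topology)"
    by (simp add: compact_space_def finite_imp_compact)
  then have "compact_space (product_topology (\<lambda>_::nat. euclidean :: bool topology) UNIV)"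
    by (simp only: compact_space_product_topology) simp
  then show ?thesis
    by (simp add: compact_space_def euclidean_product_topology)
qed

lemma range_apply_bcontfun_cantor:
  "range (apply_bcontfun :: (cantor \<Rightarrow>\<^sub>C real) \<Rightarrow> _) = {f. continuous_on UNIV f}"
proof -
  have "bounded (range f)" if "continuous_on UNIV f" for f :: "cantor \<Rightarrow> real"
    using compact_continuous_image[OF that compact_UNIV_cantor] by (rule compact_imp_bounded)
  then have "bcontfun = {f :: cantor \<Rightarrow> real. continuous_on UNIV f}"
    by (auto simp: bcontfun_def)
  then show ?thesis
    using type_definition.Rep_range[OF type_definition_bcontfun] by metis
qed

lemma norm_cantor: "norm f = (SUP x. \<bar>apply_bcontfun f x\<bar>)" for f :: "cantor \<Rightarrow>\<^sub>C real"
  by (simp add: norm_bcontfun_def dist_bcontfun.rep_eq)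

lemma complete_cantor: "complete (UNIV :: (cantor \<Rightarrow>\<^sub>C real) set)"
  unfolding complete_def
proof (intro allI impI)
  fix f :: "nat \<Rightarrow> cantor \<Rightarrow>\<^sub>C real"
  assume f: "(\<forall>n. f n \<in> UNIV) \<and> Cauchy f"
  then have "Cauchy f" by simp
  then obtain g where "uniform_limit UNIV f g sequentially"
    using uniformly_convergent_eq_cauchy[of "\<lambda>_. True" f]
    unfolding Cauchy_def uniform_limit_sequentially_iff
    by (metis dist_fun_lt_imp_dist_val_lt)
  from uniform_limit_bcontfunE[OF this sequentially_bot]
  show "\<exists>l\<in>UNIV. f \<longlonglongrightarrow> l" by (metis UNIV_I)
qed

end

theory Submission
  imports Defs
begin

text \<open>The involution \<open>h\<^sub>n\<close> exchanging the cylinders over \<open>0\<^sup>n\<^sup>+\<^sup>11\<close> and \<open>1\<^sup>n\<^sup>+\<^sup>10\<close> induces an isometry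
  \<open>T\<^sub>n f = f \<circ> h\<^sub>n\<close>. The functions \<open>T\<^sub>n f - f\<close> are uniformly bounded with pairwise disjoint supports,
  so each bounded functional has absolutely summable values on them (choose signs and add up); hence
  \<open>T\<^sub>n\<close> converges weakly to the identity. It does not converge strongly, because \<open>h\<^sub>n\<close> always moves
  some point to one with a different first coordinate.\<close>

text \<open>\<open>Blinfun\<close> and \<open>Bcontfun\<close> are only meaningful on arguments of
  the right kind, so facts about \<open>precomp h\<close> assume that \<open>h\<close> is
  continuous.\<close>

definition precomp ::
    "('a::topological_space \<Rightarrow> 'a) \<Rightarrow> ('a \<Rightarrow>\<^sub>C 'b::real_normed_vector) \<Rightarrow>\<^sub>L ('a \<Rightarrow>\<^sub>C 'b)"
  where "precomp h = Blinfun (\<lambda>f. Bcontfun (\<lambda>x. apply_bcontfun f (h x)))"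

lemma apply_Bcontfun_compose:
  assumes "continuous_on UNIV h"
  shows "apply_bcontfun (Bcontfun (\<lambda>x. apply_bcontfun f (h x))) = (\<lambda>x. apply_bcontfun f (h x))"
proof (rule Bcontfun_inverse)
  have "continuous_on UNIV (\<lambda>x. apply_bcontfun f (h x))"
    using continuous_on_compose2[OF continuous_on_apply_bcontfun[where T = UNIV] assms] by simp
  moreover have "bounded (range (\<lambda>x. apply_bcontfun f (h x)))"
    by (rule bounded_subset[OF bounded_apply_bcontfun[of f]]) auto
  ultimately show "(\<lambda>x. apply_bcontfun f (h x)) \<in> bcontfun"
    by (simp add: bcontfun_def)
qed

lemma apply_precomp:
  assumes "continuous_on UNIV h"
  shows "apply_bcontfun (blinfun_apply (precomp h) f) x = apply_bcontfun f (h x)"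
proof -
  have "bounded_linear (\<lambda>f :: 'a \<Rightarrow>\<^sub>C 'b. Bcontfun (\<lambda>x. apply_bcontfun f (h x)))"
  proof (rule bounded_linear_intro[where K = 1])
    fix f :: "'a \<Rightarrow>\<^sub>C 'b"
    show "norm (Bcontfun (\<lambda>x. apply_bcontfun f (h x))) \<le> norm f * 1"
      by (rule norm_bound) (simp add: apply_Bcontfun_compose[OF assms] norm_bounded)
  \<comment> \<open>Additivity and homogeneity remain; both hold pointwise.\<close>
  qed (rule bcontfun_eqI, simp only: apply_Bcontfun_compose[OF assms],
      simp add: apply_Bcontfun_compose[OF assms])+
  then show ?thesis
    by (simp add: precomp_def bounded_linear_Blinfun_apply apply_Bcontfun_compose[OF assms])
qed

text \<open>Composition with \<open>h\<close> never increases the supremum norm. It is its own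
  inverse, so this bound, used for \<open>f\<close> and for its image, gives equality of norms, and
  surjectivity is immediate.\<close>

lemma precomp_involution_in_Isom:
  assumes cont: "continuous_on UNIV h" and inv: "\<And>x. h (h x) = x"
  shows "precomp h \<in> Isom"
proof -
  have twice: "blinfun_apply (precomp h) (blinfun_apply (precomp h) f) = f" for f :: "'a \<Rightarrow>\<^sub>C 'b"
    by (rule bcontfun_eqI) (simp add: apply_precomp[OF cont] inv)
  have le: "norm (blinfun_apply (precomp h) f) \<le> norm f" for f :: "'a \<Rightarrow>\<^sub>C 'b"
    by (rule norm_bound) (simp add: apply_precomp[OF cont] norm_bounded)
  have "norm (blinfun_apply (precomp h) f) = norm f" for f :: "'a \<Rightarrow>\<^sub>C 'b"
    using le[of f] le[of "blinfun_apply (precomp h) f"] by (simp add: twice)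
  moreover have "surj (blinfun_apply (precomp h :: ('a \<Rightarrow>\<^sub>C 'b) \<Rightarrow>\<^sub>L ('a \<Rightarrow>\<^sub>C 'b)))"
    using twice by (rule surjI)
  ultimately show ?thesis
    by (simp add: Isom_def)
qed

lemma id_blinfun_in_Isom: "id_blinfun \<in> Isom"
  by (simp add: Isom_def surj_def)

lemma apply_bcontfun_sum:
  "apply_bcontfun (\<Sum>i\<in>I. g i) x = (\<Sum>i\<in>I. apply_bcontfun (g i) x)"
  by (induction I rule: infinite_finite_induct) auto

lemma bounded_functional_disjoint_supports_tendsto_zero:
  fixes \<phi> :: "('a::topological_space \<Rightarrow>\<^sub>C real) \<Rightarrow>\<^sub>L real" and g :: "nat \<Rightarrow> 'a \<Rightarrow>\<^sub>C real"
  assumes bound: "\<And>n. norm (g n) \<le> M"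
    and disj: "\<And>m n x. apply_bcontfun (g m) x \<noteq> 0 \<Longrightarrow> apply_bcontfun (g n) x \<noteq> 0 \<Longrightarrow> m = n"
  shows "(\<lambda>n. blinfun_apply \<phi> (g n)) \<longlonglongrightarrow> 0"
proof -
  have "(\<Sum>n<N. \<bar>blinfun_apply \<phi> (g n)\<bar>) \<le> norm \<phi> * M" for N
  proof -
    \<comment> \<open>With these signs \<phi> maps \<open>S\<close> to the sum of the absolute
      values. At each point at most one summand of \<open>S\<close> is nonzero, so the norm of
      \<open>S\<close> is bounded by \<open>M\<close>, whatever \<open>N\<close> is.\<close>
    define s where "s n = sgn (blinfun_apply \<phi> (g n))" for n
    define S where "S = (\<Sum>n<N. s n *\<^sub>R g n)"
    have "norm (apply_bcontfun S x) \<le> M" for x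
    proof (cases "\<exists>n<N. apply_bcontfun (g n) x \<noteq> 0")
      case True
      then obtain n where n: "n < N" "apply_bcontfun (g n) x \<noteq> 0" by blast
      then have "apply_bcontfun (g m) x = 0" if "m \<noteq> n" for m
        using disj that by blast
      then have "apply_bcontfun S x = (\<Sum>m<N. if m = n then s n * apply_bcontfun (g n) x else 0)"
        unfolding S_def apply_bcontfun_sum by (intro sum.cong) auto
      then have "\<bar>apply_bcontfun S x\<bar> = \<bar>s n\<bar> * \<bar>apply_bcontfun (g n) x\<bar>"
        using n by (simp add: abs_mult)
      also have "\<dots> \<le> 1 * norm (g n)"
        using norm_bounded[of "g n" x] by (intro mult_mono) (auto simp: s_def sgn_if)
      finally show ?thesis
        using bound[of n] by simp
    next
      case False
      then have "apply_bcontfun S x = 0"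
        unfolding S_def apply_bcontfun_sum by (intro sum.neutral) auto
      \<comment> \<open>Since \<open>M\<close> bounds a norm, it is nonnegative.\<close>
      then show ?thesis
        using order_trans[OF norm_ge_zero bound] by simp
    qed
    then have "norm S \<le> M"
      by (rule norm_bound)
    have "(\<Sum>n<N. \<bar>blinfun_apply \<phi> (g n)\<bar>) = blinfun_apply \<phi> S"
      by (simp add: S_def s_def blinfun.sum_right blinfun.scaleR_right linordered_idom_class.abs_sgn
          mult.commute)
    also have "\<dots> \<le> norm \<phi> * norm S"
      using norm_blinfun[of \<phi> S] by simp
    also have "\<dots> \<le> norm \<phi> * M"
      using \<open>norm S \<le> M\<close> by (simp add: mult_left_mono)
    finally show ?thesis .
  qed
  then have "summable (\<lambda>n. \<bar>blinfun_apply \<phi> (g n)\<bar>)"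
    by (intro bounded_imp_summable[where B = "norm \<phi> * M"])
      (simp_all only: lessThan_Suc_atMost[symmetric] abs_ge_zero)
  then show ?thesis
    using summable_LIMSEQ_zero tendsto_rabs_zero_iff by blast
qed

text \<open>Convergence can be tested on a subbasis: the condition passes to finite intersections
  and arbitrary unions. The first assumption places \<open>l\<close> in the topspace, which is the
  union of \<open>B\<close>.\<close>

lemma limitin_topology_generated_by:
  assumes "l \<in> \<Union>B" and "\<And>U. U \<in> B \<Longrightarrow> l \<in> U \<Longrightarrow> \<forall>\<^sub>F n in F. f n \<in> U"
  shows "limitin (topology_generated_by B) f l F"
  unfolding limitin_def
proof (intro conjI allI impI)
  show "l \<in> topspace (topology_generated_by B)"
    using assms(1) by simp
  fix U assume "openin (topology_generated_by B) U \<and> l \<in> U"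
  then have "generate_topology_on B U" and "l \<in> U"
    by (auto simp: openin_topology_generated_by_iff)
  then show "\<forall>\<^sub>F n in F. f n \<in> U"
  proof (induction rule: generate_topology_on.induct)
    case (Int U V)
    then show ?case by (auto intro: eventually_conj)
  next
    case (UN K)
    then obtain k where "k \<in> K" "\<forall>\<^sub>F n in F. f n \<in> k" by blast
    then show ?case by (auto elim: eventually_mono)
  qed (use assms in auto)
qed

lemma limitin_weak_operator_topology:
  assumes "\<And>(\<phi> :: 'b \<Rightarrow>\<^sub>L real) x.
    ((\<lambda>n. blinfun_apply \<phi> (blinfun_apply (T n) x)) \<longlongrightarrow> blinfun_apply \<phi> (blinfun_apply L x)) F"
  shows "limitin weak_operator_topology
    (T :: _ \<Rightarrow> 'a::real_normed_vector \<Rightarrow>\<^sub>L 'b::real_normed_vector) L F"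
  unfolding weak_operator_topology_def
proof (rule limitin_topology_generated_by)
  show "L \<in> \<Union>{{T. blinfun_apply \<phi> (blinfun_apply T x) \<in> U} | (\<phi> :: 'b \<Rightarrow>\<^sub>L real) x U. open U}"
    using open_UNIV by blast
next
  fix V
  assume "V \<in> {{T. blinfun_apply \<phi> (blinfun_apply T x) \<in> U} | (\<phi> :: 'b \<Rightarrow>\<^sub>L real) x U. open U}" "L \<in> V"
  then obtain \<phi> :: "'b \<Rightarrow>\<^sub>L real" and x U where V: "V = {T. blinfun_apply \<phi> (blinfun_apply T x) \<in> U}"
    and "open U" "blinfun_apply \<phi> (blinfun_apply L x) \<in> U"
    by auto
  then have "\<forall>\<^sub>F n in F. blinfun_apply \<phi> (blinfun_apply (T n) x) \<in> U"
    using assms topological_tendstoD by blast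
  then show "\<forall>\<^sub>F n in F. T n \<in> V"
    by (simp add: V)
qed

text \<open>As there are only two truth values, \<open>x 0\<close>, ..., \<open>x n\<close> all
  equal the negation of \<open>x (Suc n)\<close>. So \<open>Suc n\<close> is the first index at
  which \<open>x\<close> differs from \<open>x 0\<close>, and the set is the union of the two
  cylinders to be exchanged.\<close>

definition turning_at :: "nat \<Rightarrow> cantor set"
  where "turning_at n = {x. \<forall>i\<le>n. x i \<noteq> x (Suc n)}"

text \<open>The turning position \<open>Suc n\<close> is flipped too, so that
  \<open>turning_at n\<close> is mapped to itself and a second application undoes the first.\<close>

definition flip_prefix :: "nat \<Rightarrow> cantor \<Rightarrow> cantor"
  where "flip_prefix n x = (\<lambda>i. if x \<in> turning_at n \<and> i \<le> Suc n then \<not> x i else x i)"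

lemma turning_at_disjoint:
  assumes "x \<in> turning_at m" "x \<in> turning_at n"
  shows "m = n"
proof -
  have "\<not> i < j" if "x \<in> turning_at i" "x \<in> turning_at j" for i j
  proof
    assume "i < j"
    \<comment> \<open>Three truth values cannot be pairwise distinct; the last inequality uses
      \<open>Suc i \<le> j\<close>.\<close>
    then have "x 0 \<noteq> x (Suc i)" "x 0 \<noteq> x (Suc j)" "x (Suc i) \<noteq> x (Suc j)"
      using that Suc_leI unfolding turning_at_def by blast+
    then show False by blast
  qed
  then show ?thesis
    using assms by (meson linorder_neqE_nat)
qed

lemma flip_prefix_involution: "flip_prefix n (flip_prefix n x) = x"
proof (cases "x \<in> turning_at n")
  case True
  then have "flip_prefix n x \<in> turning_at n"
    by (auto simp: flip_prefix_def turning_at_def)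
  then show ?thesis
    using True by (auto simp: flip_prefix_def)
qed (auto simp: flip_prefix_def)

text \<open>Every output coordinate depends on finitely many input coordinates only, hence is
  locally constant.\<close>

lemma continuous_flip_prefix: "continuous_on UNIV (flip_prefix n)"
proof (rule continuous_on_coordinatewise_then_product)
  fix i
  have "((\<lambda>y. flip_prefix n y i) \<longlongrightarrow> flip_prefix n x i) (at x)" for x :: cantor
  proof -
    have "\<forall>\<^sub>F y in at x. y j = x j" for j
    proof -
      have "((\<lambda>y :: cantor. y j) \<longlongrightarrow> x j) (at x)"
        using continuous_on_product_coordinates[of j, where 'b = bool] unfolding continuous_on_def
        by blast
      then show ?thesis by (simp add: tendsto_discrete)
    qed
    \<comment> \<open>Coordinates up to \<open>Suc n\<close> decide membership in
      \<open>turning_at n\<close>; coordinate \<open>i\<close> then decides the value.\<close>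
    then have "\<forall>\<^sub>F y in at x. \<forall>j\<in>{..max i (Suc n)}. y j = x j"
      by (intro eventually_ball_finite) auto
    then have "\<forall>\<^sub>F y in at x. flip_prefix n y i = flip_prefix n x i"
    proof eventually_elim
      case (elim y)
      then have "y \<in> turning_at n \<longleftrightarrow> x \<in> turning_at n"
        by (auto simp: turning_at_def)
      then show ?case
        using elim by (auto simp: flip_prefix_def)
    qed
    then show ?thesis by (rule tendsto_eventually)
  qed
  then show "continuous_on UNIV (\<lambda>x. flip_prefix n x i)"
    by (simp add: continuous_on_def)
qed

lemma precomp_flip_prefix_weak_limit:
  "limitin weak_operator_topology
    (\<lambda>n. precomp (flip_prefix n) :: (cantor \<Rightarrow>\<^sub>C real) \<Rightarrow>\<^sub>L (cantor \<Rightarrow>\<^sub>C real)) id_blinfun sequentially"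
proof (rule limitin_weak_operator_topology)
  fix \<phi> :: "(cantor \<Rightarrow>\<^sub>C real) \<Rightarrow>\<^sub>L real" and f :: "cantor \<Rightarrow>\<^sub>C real"
  define g where "g n = blinfun_apply (precomp (flip_prefix n)) f - f" for n
  have g: "apply_bcontfun (g n) x = apply_bcontfun f (flip_prefix n x) - apply_bcontfun f x" for n x
    by (simp add: g_def apply_precomp continuous_flip_prefix)
  have "(\<lambda>n. blinfun_apply \<phi> (g n)) \<longlonglongrightarrow> 0"
  proof (rule bounded_functional_disjoint_supports_tendsto_zero)
    show "norm (g n) \<le> 2 * norm f" for n
    proof (rule norm_bound)
      show "norm (apply_bcontfun (g n) x) \<le> 2 * norm f" for x
        using norm_bounded[of f x] norm_bounded[of f "flip_prefix n x"] by (simp add: g)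
    qed
    \<comment> \<open>Off \<open>turning_at n\<close> the involution fixes every point, so
      \<open>g n\<close> vanishes there.\<close>
    have "x \<in> turning_at n" if "apply_bcontfun (g n) x \<noteq> 0" for n x
      using that by (cases "x \<in> turning_at n") (simp_all add: g flip_prefix_def)
    then show "m = n" if "apply_bcontfun (g m) x \<noteq> 0" "apply_bcontfun (g n) x \<noteq> 0" for m n x
      using that turning_at_disjoint by blast
  qed
  then show "(\<lambda>n. blinfun_apply \<phi> (blinfun_apply (precomp (flip_prefix n)) f))
      \<longlonglongrightarrow> blinfun_apply \<phi> (blinfun_apply id_blinfun f)"
    by (simp add: g_def blinfun.diff_right LIM_zero_iff)
qed

lemma precomp_flip_prefix_not_strong_limit:
  "\<not> limitin strong_operator_topology
    (\<lambda>n. precomp (flip_prefix n) :: (cantor \<Rightarrow>\<^sub>C real) \<Rightarrow>\<^sub>L (cantor \<Rightarrow>\<^sub>C real)) id_blinfun sequentially"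
proof
  assume lim: "limitin strong_operator_topology
    (\<lambda>n. precomp (flip_prefix n) :: (cantor \<Rightarrow>\<^sub>C real) \<Rightarrow>\<^sub>L (cantor \<Rightarrow>\<^sub>C real)) id_blinfun sequentially"
  \<comment> \<open>The test function reads coordinate 0, which every \<open>flip_prefix n\<close>
    negates on \<open>turning_at n\<close>.\<close>
  have "continuous_on UNIV (\<lambda>x :: cantor. of_bool (x 0) :: real)"
    by (rule continuous_on_compose2[of UNIV of_bool])
      (auto intro: continuous_on_product_coordinates)
  then obtain f :: "cantor \<Rightarrow>\<^sub>C real" where f: "\<And>x. apply_bcontfun f x = of_bool (x 0)"
    using range_apply_bcontfun_cantor by (metis (mono_tags, lifting) imageE mem_Collect_eq)
  have "limitin euclidean (\<lambda>n. blinfun_apply (precomp (flip_prefix n)) f) f sequentially"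
    using continuous_map_limit[OF strong_operator_topology_continuous_evaluation lim, of f]
    by (simp add: o_def)
  then have "(\<lambda>n. blinfun_apply (precomp (flip_prefix n)) f) \<longlonglongrightarrow> f"
    by simp
  then have "\<forall>\<^sub>F n in sequentially. dist (blinfun_apply (precomp (flip_prefix n)) f) f < 1"
    by (rule tendstoD) simp
  then obtain n where n: "dist (blinfun_apply (precomp (flip_prefix n)) f) f < 1"
    by (auto simp: eventually_sequentially)
  \<comment> \<open>Exactly \<open>n + 1\<close> leading ones followed by zeros, so \<open>x\<close>
    lies in \<open>turning_at n\<close>.\<close>
  define x :: cantor where "x i = (i \<le> n)" for i
  have "dist (apply_bcontfun (blinfun_apply (precomp (flip_prefix n)) f) x) (apply_bcontfun f x) = 1"
    unfolding apply_precomp[OF continuous_flip_prefix] f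
    by (simp add: flip_prefix_def turning_at_def x_def)
  then show False
    using dist_bounded[of "blinfun_apply (precomp (flip_prefix n)) f" x f] n by simp
qed

theorem corollary5p6:
  shows "\<not> light_space TYPE(cantor \<Rightarrow>\<^sub>C real)"
proof
  assume "light_space TYPE(cantor \<Rightarrow>\<^sub>C real)"
  then have eq: "subtopology weak_operator_topology Isom =
      (subtopology strong_operator_topology Isom :: ((cantor \<Rightarrow>\<^sub>C real) \<Rightarrow>\<^sub>L (cantor \<Rightarrow>\<^sub>C real)) topology)"
    by (simp add: light_space_def light_group_def)
  have "precomp (flip_prefix n) \<in> (Isom :: ((cantor \<Rightarrow>\<^sub>C real) \<Rightarrow>\<^sub>L (cantor \<Rightarrow>\<^sub>C real)) set)" for n
    by (intro precomp_involution_in_Isom continuous_flip_prefix flip_prefix_involution)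
  \<comment> \<open>The operators and their limit lie in \<open>Isom\<close>, so convergence there
    agrees with convergence in the ambient topology, and equal subspace topologies would turn the
    weak limit into a strong one.\<close>
  then have "limitin X (\<lambda>n. precomp (flip_prefix n)) id_blinfun sequentially \<longleftrightarrow>
      limitin (subtopology X Isom) (\<lambda>n. precomp (flip_prefix n)) id_blinfun sequentially"
    for X :: "((cantor \<Rightarrow>\<^sub>C real) \<Rightarrow>\<^sub>L (cantor \<Rightarrow>\<^sub>C real)) topology"
    by (simp add: limitin_subtopology id_blinfun_in_Isom)
  then show False
    using precomp_flip_prefix_weak_limit precomp_flip_prefix_not_strong_limit eq by metis
qed

end
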